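(* Let $X$ be a reflexive real Banach space and let $T\subset X\times X^*$ be a maximal monotone operator. Then $T$ is non-enlargeable if and only if there exist a self-cancelling operator $A\subset X\times X^*$ and a point $(x,x^* )\in X\times X^*$ such that $A^\vdash$ is maximal monotone and \[ T=A^\vdash+\{(x,x^* )\}=\{(y+x,y^*+x^* )\mid (y,y^* )\in A^\vdash\}. \] Moreover, if $T$ is non-enlargeable and $(x,x^* )\in T$, then the maximal (with respect to inclusion) $A\subset X\times X^*$ satisfying $T-\{(x,x^* )\}=A^\vdash$ is $(T-\{(x,x^* )\})^\vdash$, where $T-\{(x,x^* )\}=\{(y-x,y^*-x^* )\mid (y,y^* )\in T\}$.
   Context: $X^*$ is the topological dual of $X$ and $\langle x,x^*\rangle=x^*(x)$. An operator $T:X\rightrightarrows X^*$ is identified with a subset of $X\times X^*$. $T$ is monotone if $\langle x-y,x^*-y^*\rangle\ge 0$ for all $(x,x^* ),(y,y^* )\in T$, and maximal monotone if it is monotone and not properly contained in any monotone operator. For a maximal monotone $T$ and $\varepsilon\ge 0$, the enlargement is $T^\varepsilon=\{(x,x^* )\mid \langle x-y,x^*-y^*\rangle\ge-\varepsilon\ \forall (y,y^* )\in T\}$; $T$ is called non-enlargeable if $T^\varepsilon=T$ for all $\varepsilon\ge0$. For $B\subset X\times X^*$, $B^\vdash=\{(y,y^* )\in X\times X^*\mid \langle x,y^*\rangle+\langle y,x^*\rangle=0\ \forall (x,x^* )\in B\}$. An operator $A\subset X\times X^*$ is self-cancelling if $A$ is a linear subspace of $X\times X^*$ and $\langle x,x^*\rangle=0$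 for all $(x,x^* )\in A$. *)

theory Defs
  imports "HOL-Analysis.Analysis"
begin

definition pairing :: "'a::real_normed_vector \<Rightarrow> ('a \<Rightarrow>\<^sub>L real) \<Rightarrow> real" where
  "pairing x f = blinfun_apply f x"

definition reflexive_space :: "'a::real_normed_vector itself \<Rightarrow> bool" where
  "reflexive_space TYPE('a) \<longleftrightarrow>
     (\<forall>\<phi> :: ('a \<Rightarrow>\<^sub>L real) \<Rightarrow>\<^sub>L real. \<exists>x::'a. \<forall>f. blinfun_apply \<phi> f = blinfun_apply f x)"

definition monotone_op :: "('a::real_normed_vector \<times> ('a \<Rightarrow>\<^sub>L real)) set \<Rightarrow> bool" where
  "monotone_op T \<longleftrightarrow>
     (\<forall>x x' y y'. (x, x') \<in> T \<longrightarrow> (y, y') \<in> T \<longrightarrow> pairing (x - y) (x' - y') \<ge> 0)"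

definition maximal_monotone :: "('a::real_normed_vector \<times> ('a \<Rightarrow>\<^sub>L real)) set \<Rightarrow> bool" where
  "maximal_monotone T \<longleftrightarrow> monotone_op T \<and> (\<forall>S. monotone_op S \<and> T \<subseteq> S \<longrightarrow> S = T)"

definition enlargement ::
  "('a::real_normed_vector \<times> ('a \<Rightarrow>\<^sub>L real)) set \<Rightarrow> real \<Rightarrow> ('a \<times> ('a \<Rightarrow>\<^sub>L real)) set" where
  "enlargement T \<epsilon> =
     {(x, x'). \<forall>y y'. (y, y') \<in> T \<longrightarrow> pairing (x - y) (x' - y') \<ge> - \<epsilon>}"

definition non_enlargeable :: "('a::real_normed_vector \<times> ('a \<Rightarrow>\<^sub>L real)) set \<Rightarrow> bool" where
  "non_enlargeable T \<longleftrightarrow> (\<forall>\<epsilon>\<ge>0. enlargement T \<epsilon> = T)"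

definition perp_op ::
  "('a::real_normed_vector \<times> ('a \<Rightarrow>\<^sub>L real)) set \<Rightarrow> ('a \<times> ('a \<Rightarrow>\<^sub>L real)) set" where
  "perp_op B = {(y, y'). \<forall>x x'. (x, x') \<in> B \<longrightarrow> pairing x y' + pairing y x' = 0}"

definition self_cancelling :: "('a::real_normed_vector \<times> ('a \<Rightarrow>\<^sub>L real)) set \<Rightarrow> bool" where
  "self_cancelling A \<longleftrightarrow> subspace A \<and> (\<forall>x x'. (x, x') \<in> A \<longrightarrow> pairing x x' = 0)"

end

theory Submission
  imports Defs
begin

text \<open>
  Let \<open>q (x, x') = \<langle>x, x'\<rangle>\<close>, with polar form \<open>b\<close>, so that \<open>B\<^sup>\<turnstile>\<close> is the \<open>b\<close>-orthogonal of \<open>B\<close>.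
  The identity for \<open>q\<close> at a convex combination shows that convex combinations of points of \<open>T\<close>
  lie in some enlargement, so a non-enlargeable \<open>T\<close> is convex. A convex maximal
  monotone set containing \<open>0\<close> is a subspace, because \<open>q (2 z - w) = 4 q (z - w / 2)\<close>. If \<open>S\<close> is the
  translate of \<open>T\<close> through \<open>0\<close> and \<open>y \<in> S\<^sup>\<turnstile>\<close>, then \<open>q (y - s) = q y + q s \<ge> q y\<close> puts \<open>y\<close> into
  an enlargement of \<open>S\<close>; hence \<open>S\<^sup>\<turnstile> \<subseteq> S\<close> and \<open>S\<^sup>\<turnstile>\<close> is self-cancelling. As \<open>S\<close> is closed, the
  Hahn--Banach theorem and reflexivity give \<open>S = S\<^sup>\<turnstile>\<^sup>\<turnstile>\<close>.
  Conversely, if \<open>A\<close> is self-cancelling then \<open>A \<subseteq> A\<^sup>\<turnstile>\<close>, and for \<open>w\<close> in an enlargement of \<open>A\<^sup>\<turnstile>\<close> the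
  affine function \<open>t \<mapsto> q (w - t a) = q w - t b w a\<close> is bounded below, so \<open>b w a = 0\<close>.
\<close>

section \<open>Hahn--Banach separation\<close>

definition sublinear :: "('e::real_vector \<Rightarrow> real) \<Rightarrow> bool" where
  "sublinear p \<longleftrightarrow> (\<forall>x y. p (x + y) \<le> p x + p y) \<and> (\<forall>c x. 0 \<le> c \<longrightarrow> p (c *\<^sub>R x) = c * p x)"

lemma sublinear_add: "sublinear p \<Longrightarrow> p (x + y) \<le> p x + p y"
  by (simp add: sublinear_def)

lemma sublinear_scale: "sublinear p \<Longrightarrow> 0 \<le> c \<Longrightarrow> p (c *\<^sub>R x) = c * p x"
  by (simp add: sublinear_def)

lemma sublinear_zero: "sublinear p \<Longrightarrow> p 0 = 0"
  using sublinear_scale[of p 0 0] by simp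

lemma sublinear_ge_minus: "sublinear p \<Longrightarrow> - p (- x) \<le> p x"
  using sublinear_add[of p x "- x"] by (simp add: sublinear_zero)

text \<open>The reverse inequality in homogeneity comes from applying \<open>scale\<close> with
  factor \<open>inverse c\<close>, so only upper estimates remain to be checked; these are
  convenient for infima.\<close>

lemma sublinearI:
  assumes add: "\<And>x y. p (x + y) \<le> p x + p y"
    and scale: "\<And>c x. 0 < c \<Longrightarrow> p (c *\<^sub>R x) \<le> c * p x"
    and zero: "p 0 = 0"
  shows "sublinear p"
  unfolding sublinear_def
proof (intro conjI allI impI)
  fix c :: real and x
  assume c: "0 \<le> c"
  show "p (c *\<^sub>R x) = c * p x"
  proof (cases "c = 0")
    case False
    then have "0 < c" using c by simp
    then have "p (inverse c *\<^sub>R c *\<^sub>R x) \<le> inverse c * p (c *\<^sub>R x)"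
      by (intro scale) simp
    then have "c * p x \<le> p (c *\<^sub>R x)"
      using \<open>0 < c\<close> by (simp add: field_simps)
    with scale[OF \<open>0 < c\<close>, of x] show ?thesis by simp
  qed (simp add: zero)
qed (rule add)

text \<open>Lowers \<open>p\<close> to the largest sublinear functional below it with value \<open>- p y\<close> at \<open>- y\<close>;
  a sublinear functional that cannot be lowered in this way is linear.\<close>

definition lower_along :: "('e::real_vector \<Rightarrow> real) \<Rightarrow> 'e \<Rightarrow> 'e \<Rightarrow> real" where
  "lower_along p y x = (INF t\<in>{0..}. p (x + t *\<^sub>R y) - t * p y)"

context
  fixes p :: "'e::real_vector \<Rightarrow> real" and y :: 'e
  assumes p: "sublinear p"
begin

text \<open>A bound independent of \<open>t\<close>, which makes the infimum in
  \<open>lower_along\<close> finite.\<close>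

lemma lower_along_ge_minus: "0 \<le> t \<Longrightarrow> - p (- x) \<le> p (x + t *\<^sub>R y) - t * p y"
  using sublinear_add[OF p, of "x + t *\<^sub>R y" "- x"] sublinear_scale[OF p, of t y] by simp

lemma lower_along_bdd: "bdd_below ((\<lambda>t. p (x + t *\<^sub>R y) - t * p y) ` {0..})"
  using lower_along_ge_minus by (intro bdd_belowI2[of _ "- p (- x)"]) auto

lemma lower_along_le: "0 \<le> t \<Longrightarrow> lower_along p y x \<le> p (x + t *\<^sub>R y) - t * p y"
  unfolding lower_along_def by (rule cINF_lower[OF lower_along_bdd]) simp

lemma lower_along_greatest:
  "(\<And>t. 0 \<le> t \<Longrightarrow> m \<le> p (x + t *\<^sub>R y) - t * p y) \<Longrightarrow> m \<le> lower_along p y x"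
  unfolding lower_along_def by (rule cINF_greatest) auto

lemma lower_along_below: "lower_along p y x \<le> p x"
  using lower_along_le[of 0 x] by simp

lemma lower_along_minus: "lower_along p y (- y) \<le> - p y"
  using lower_along_le[of 1 "- y"] by (simp add: sublinear_zero[OF p])

lemma sublinear_lower_along: "sublinear (lower_along p y)"
proof (rule sublinearI)
  fix u v
  \<comment> \<open>The two infima are taken one after the other: the parameters \<open>t\<close>
    for \<open>u\<close> and \<open>s\<close> for \<open>v\<close> combine to the competitor
    \<open>s + t\<close> for \<open>u + v\<close>.\<close>
  have "lower_along p y (u + v) - (p (v + s *\<^sub>R y) - s * p y) \<le> lower_along p y u" if "0 \<le> s" for s
  proof (rule lower_along_greatest)
    fix t :: real assume "0 \<le> t"
    have "p ((u + v) + (s + t) *\<^sub>R y) \<le> p (u + t *\<^sub>R y) + p (v + s *\<^sub>R y)"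
      using sublinear_add[OF p, of "u + t *\<^sub>R y" "v + s *\<^sub>R y"] by (simp add: algebra_simps)
    moreover have "lower_along p y (u + v) \<le> p ((u + v) + (s + t) *\<^sub>R y) - (s + t) * p y"
      using that \<open>0 \<le> t\<close> by (intro lower_along_le) simp
    ultimately show "lower_along p y (u + v) - (p (v + s *\<^sub>R y) - s * p y) \<le> p (u + t *\<^sub>R y) - t * p y"
      by (simp add: algebra_simps)
  qed
  then have "lower_along p y (u + v) - lower_along p y u \<le> lower_along p y v"
    by (intro lower_along_greatest) (simp add: algebra_simps)
  then show "lower_along p y (u + v) \<le> lower_along p y u + lower_along p y v" by simp
next
  fix c :: real and x assume c: "0 < c"
  have "lower_along p y (c *\<^sub>R x) / c \<le> lower_along p y x"
  proof (rule lower_along_greatest)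
    fix t :: real assume t: "0 \<le> t"
    have "lower_along p y (c *\<^sub>R x) \<le> p (c *\<^sub>R x + (c * t) *\<^sub>R y) - (c * t) * p y"
      using c t by (intro lower_along_le) simp
    also have "\<dots> = c * (p (x + t *\<^sub>R y) - t * p y)"
      using sublinear_scale[OF p, of c "x + t *\<^sub>R y"] c by (simp add: algebra_simps)
    finally show "lower_along p y (c *\<^sub>R x) / c \<le> p (x + t *\<^sub>R y) - t * p y"
      using c by (simp add: field_simps)
  qed
  then show "lower_along p y (c *\<^sub>R x) \<le> c * lower_along p y x"
    using c by (simp add: field_simps)
next
  show "lower_along p y 0 = 0"
  proof (rule antisym)
    show "lower_along p y 0 \<le> 0"
      using lower_along_below[of 0] by (simp add: sublinear_zero[OF p])
    show "0 \<le> lower_along p y 0"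
      by (rule lower_along_greatest) (simp add: sublinear_scale[OF p])
  qed
qed

end

text \<open>The chain condition gives subadditivity: functionals chosen separately for
  \<open>x\<close> and \<open>y\<close> can both be replaced by the smaller one.\<close>

lemma sublinear_INF_chain:
  fixes C :: "('e::real_vector \<Rightarrow> real) set"
  assumes ne: "C \<noteq> {}" and sub: "\<And>p. p \<in> C \<Longrightarrow> sublinear p"
    and chain: "\<And>p q. p \<in> C \<Longrightarrow> q \<in> C \<Longrightarrow> p \<le> q \<or> q \<le> p"
    and bdd: "\<And>x. bdd_below ((\<lambda>p. p x) ` C)"
  shows "sublinear (\<lambda>x. INF p\<in>C. p x)"
proof (rule sublinearI)
  fix x y
  have "(INF r\<in>C. r (x + y)) \<le> p x + q y" if pq: "p \<in> C" "q \<in> C" for p q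
  proof -
    obtain r where r: "r \<in> C" "r \<le> p" "r \<le> q"
      using chain[OF pq] pq by auto
    have "(INF r\<in>C. r (x + y)) \<le> r (x + y)"
      by (rule cINF_lower[OF bdd r(1)])
    also have "\<dots> \<le> r x + r y"
      by (rule sublinear_add[OF sub[OF r(1)]])
    also have "\<dots> \<le> p x + q y"
      using r by (intro add_mono) (auto simp: le_fun_def)
    finally show ?thesis .
  qed
  then have "(INF r\<in>C. r (x + y)) - q y \<le> (INF p\<in>C. p x)" if "q \<in> C" for q
    using that by (intro cINF_greatest[OF ne]) (simp add: algebra_simps)
  then have "(INF r\<in>C. r (x + y)) - (INF p\<in>C. p x) \<le> (INF q\<in>C. q y)"
    by (intro cINF_greatest[OF ne]) (simp add: algebra_simps)
  then show "(INF p\<in>C. p (x + y)) \<le> (INF p\<in>C. p x) + (INF p\<in>C. p y)" by simp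
next
  fix c :: real and x assume c: "0 < c"
  have "(INF p\<in>C. p (c *\<^sub>R x)) / c \<le> (INF p\<in>C. p x)"
  proof (rule cINF_greatest[OF ne])
    fix p assume pC: "p \<in> C"
    have "(INF p\<in>C. p (c *\<^sub>R x)) \<le> p (c *\<^sub>R x)"
      by (rule cINF_lower[OF bdd pC])
    then show "(INF p\<in>C. p (c *\<^sub>R x)) / c \<le> p x"
      using c by (simp add: sublinear_scale[OF sub[OF pC]] field_simps)
  qed
  then show "(INF p\<in>C. p (c *\<^sub>R x)) \<le> c * (INF p\<in>C. p x)"
    using c by (simp add: field_simps)
next
  have "(\<lambda>p. p 0) ` C = {0}"
    using ne sublinear_zero[OF sub] by (auto simp: image_iff)
  then show "(INF p\<in>C. p 0) = 0" by simp
qed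

text \<open>Zorn's lemma for the reversed pointwise order. The lower bound
  \<open>- p0 (- x)\<close>, common to all sublinear \<open>p\<close> below \<open>p0\<close>, keeps
  infima of chains finite.\<close>

lemma minimal_sublinear_exists:
  fixes p0 :: "'e::real_vector \<Rightarrow> real"
  assumes p0: "sublinear p0"
  obtains p where "sublinear p" "p \<le> p0" "\<And>r. sublinear r \<Longrightarrow> r \<le> p \<Longrightarrow> r = p"
proof -
  let ?A = "{p. sublinear p \<and> p \<le> p0}"
  have ge: "- p0 (- x) \<le> p x" if "p \<in> ?A" for p x
  proof -
    have "p (- x) \<le> p0 (- x)" using that by (simp add: le_fun_def)
    moreover have "- p (- x) \<le> p x" using that by (simp add: sublinear_ge_minus)
    ultimately show ?thesis by simp
  qed
  have "\<exists>m\<in>?A. \<forall>a\<in>?A. a \<le> m \<longrightarrow> a = m"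
  proof (rule predicate_Zorn)
    show "partial_order_on ?A (relation_of (\<lambda>p r. r \<le> p) ?A)"
      by (rule partial_order_on_relation_ofI) auto
    fix C assume C: "C \<in> Chains (relation_of (\<lambda>p r. r \<le> p) ?A)"
    then have CA: "C \<subseteq> ?A" and chain: "\<And>p q. p \<in> C \<Longrightarrow> q \<in> C \<Longrightarrow> p \<le> q \<or> q \<le> p"
      unfolding Chains_def relation_of_def by auto
    show "\<exists>u\<in>?A. \<forall>a\<in>C. u \<le> a"
    proof (cases "C = {}")
      case True
      then show ?thesis using p0 by auto
    next
      case False
      have bdd: "bdd_below ((\<lambda>p. p x) ` C)" for x
        using ge CA by (intro bdd_belowI2[of _ "- p0 (- x)"]) auto
      let ?u = "\<lambda>x. INF p\<in>C. p x"
      have le: "?u \<le> p" if "p \<in> C" for p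
        unfolding le_fun_def using cINF_lower[OF bdd that] by blast
      obtain p where "p \<in> C" using False by auto
      then have "p \<le> p0" using CA by blast
      with le[OF \<open>p \<in> C\<close>] have "?u \<le> p0" by (rule order_trans)
      moreover have "sublinear ?u"
        by (rule sublinear_INF_chain[OF False _ chain bdd]) (use CA in auto)
      ultimately show ?thesis using le by blast
    qed
  qed
  then obtain m where m: "m \<in> ?A" "\<forall>a\<in>?A. a \<le> m \<longrightarrow> a = m" by blast
  show thesis
  proof (rule that)
    show "r = m" if "sublinear r" "r \<le> m" for r
      using m that order_trans[of r m p0] by simp
  qed (use m in simp_all)
qed

text \<open>A minimal \<open>p\<close> equals each \<open>lower_along p y\<close>, whose value at
  \<open>- y\<close> is at most \<open>- p y\<close>. Hence \<open>p\<close> is odd, and an odd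
  sublinear functional is linear.\<close>

lemma Hahn_Banach_sublinear:
  fixes p0 :: "'e::real_vector \<Rightarrow> real"
  assumes p0: "sublinear p0"
  obtains f where "linear f" "f \<le> p0"
proof -
  obtain p where p: "sublinear p" "p \<le> p0"
    and min: "\<And>r. sublinear r \<Longrightarrow> r \<le> p \<Longrightarrow> r = p"
    using minimal_sublinear_exists[OF p0] by blast
  have "p (- y) \<le> - p y" for y
  proof -
    have "lower_along p y = p"
      by (rule min) (simp_all add: p sublinear_lower_along le_fun_def lower_along_below)
    then show ?thesis using lower_along_minus[OF p(1), of y] by simp
  qed
  then have minus: "p (- y) = - p y" for y
    using sublinear_ge_minus[OF p(1), of y] by (simp add: antisym)
  have "linear p"
  proof (rule linearI)
    fix x y
    show "p (x + y) = p x + p y"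
      using sublinear_add[OF p(1), of x y] sublinear_add[OF p(1), of "- x" "- y"] minus[of "x + y"]
      by (simp add: minus)
  next
    fix c :: real and x
    show "p (c *\<^sub>R x) = c *\<^sub>R p x"
      using sublinear_scale[OF p(1), of c x] sublinear_scale[OF p(1), of "- c" x] minus[of "c *\<^sub>R x"]
      by (cases "0 \<le> c") auto
  qed
  with p(2) show thesis by (rule that[rotated])
qed

section \<open>Separating a point from a closed subspace by the distance functional\<close>

lemma sublinear_infdist_subspace:
  fixes S :: "'e::real_normed_vector set"
  assumes S: "subspace S"
  shows "sublinear (\<lambda>x. infdist x S)"
proof (rule sublinearI)
  have ne: "S \<noteq> {}" using subspace_0[OF S] by auto
  have greatest: "m \<le> infdist x S" if "\<And>a. a \<in> S \<Longrightarrow> m \<le> dist x a" for m x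
    unfolding infdist_notempty[OF ne] by (rule cINF_greatest[OF ne that])
  fix x y
  have "infdist (x + y) S - dist y b \<le> infdist x S" if "b \<in> S" for b
  proof (rule greatest)
    fix a assume "a \<in> S"
    then have "infdist (x + y) S \<le> dist (x + y) (a + b)"
      using that S by (intro infdist_le subspace_add)
    also have "\<dots> \<le> dist x a + dist y b" by (rule dist_triangle_add)
    finally show "infdist (x + y) S - dist y b \<le> dist x a" by simp
  qed
  then have "infdist (x + y) S - infdist x S \<le> infdist y S"
    by (intro greatest) (simp add: algebra_simps)
  then show "infdist (x + y) S \<le> infdist x S + infdist y S" by simp
  fix c :: real assume c: "0 < c"
  have "infdist (c *\<^sub>R x) S / c \<le> infdist x S"
  proof (rule greatest)
    fix a assume "a \<in> S"
    then have "infdist (c *\<^sub>R x) S \<le> dist (c *\<^sub>R x) (c *\<^sub>R a)"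
      using S by (intro infdist_le subspace_scale)
    then show "infdist (c *\<^sub>R x) S / c \<le> dist x a"
      using c by (simp add: dist_norm pos_divide_le_eq mult.commute flip: scaleR_diff_right)
  qed
  then show "infdist (c *\<^sub>R x) S \<le> c * infdist x S"
    using c by (simp add: field_simps)
next
  show "infdist 0 S = 0" using subspace_0[OF S] by simp
qed

theorem Hahn_Banach_separate_subspace:
  fixes S :: "'e::real_normed_vector set"
  assumes S: "subspace S" "closed S" and z: "z \<notin> S"
  obtains f :: "'e \<Rightarrow>\<^sub>L real" where "\<And>s. s \<in> S \<Longrightarrow> f s = 0" "f z \<noteq> 0"
proof -
  let ?d = "\<lambda>x. infdist x S"
  have d: "sublinear ?d" by (rule sublinear_infdist_subspace[OF S(1)])
  \<comment> \<open>Domination by the lowered functional, rather than by \<open>?d\<close> alone,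
    also forces \<open>f (- z) \<le> - ?d z\<close>, which gives \<open>f z \<noteq> 0\<close> at
    the end.\<close>
  obtain f where f: "linear f" and le_lower: "f \<le> lower_along ?d z"
    using Hahn_Banach_sublinear[OF sublinear_lower_along[OF d]] by blast
  have le: "f x \<le> ?d x" for x
    using le_lower lower_along_below[OF d, of z x] by (auto simp: le_fun_def intro: order_trans)
  have abs_le: "\<bar>f x\<bar> \<le> norm x" for x
  proof -
    have "?d y \<le> norm y" for y
      using infdist_le[OF subspace_0[OF S(1)], of y] by simp
    from this[of x] this[of "- x"] show ?thesis
      using le[of x] le[of "- x"] by (simp add: linear_neg[OF f])
  qed
  have "bounded_linear f"
    using f abs_le by (intro bounded_linear_intro[of f 1]) (auto simp: linear_add linear_scale)
  then have f_apply: "blinfun_apply (Blinfun f) = f" by (rule bounded_linear_Blinfun_apply)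
  show thesis
  proof (rule that[of "Blinfun f"], unfold f_apply)
    \<comment> \<open>\<open>?d\<close> vanishes at both \<open>s\<close> and \<open>- s\<close>, so
      \<open>f s\<close> is bounded by zero from both sides.\<close>
    show "f s = 0" if "s \<in> S" for s
      using le[of s] le[of "- s"] that subspace_neg[OF S(1) that]
      by (simp add: linear_neg[OF f])
    have "0 < ?d z"
      using S z subspace_0[OF S(1)] by (intro infdist_pos_not_in_closed) auto
    moreover have "f (- z) \<le> - ?d z"
      using le_lower lower_along_minus[OF d, of z] by (auto simp: le_fun_def intro: order_trans)
    ultimately show "f z \<noteq> 0" by (simp add: linear_neg[OF f])
  qed
qed

section \<open>The duality form on the product space\<close>

definition dual_quad :: "'a::real_normed_vector \<times> ('a \<Rightarrow>\<^sub>L real) \<Rightarrow> real" where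
  "dual_quad z = pairing (fst z) (snd z)"

definition dual_polar ::
  "'a::real_normed_vector \<times> ('a \<Rightarrow>\<^sub>L real) \<Rightarrow> 'a \<times> ('a \<Rightarrow>\<^sub>L real) \<Rightarrow> real" where
  "dual_polar z w = pairing (fst z) (snd w) + pairing (fst w) (snd z)"

lemmas dual_form_simps = dual_quad_def dual_polar_def pairing_def
  blinfun.add_left blinfun.add_right blinfun.diff_left blinfun.diff_right
  blinfun.scaleR_left blinfun.scaleR_right blinfun.minus_left blinfun.minus_right

lemma dual_quad_diff: "dual_quad (z - w) = dual_quad z - dual_polar z w + dual_quad w"
  by (simp add: dual_form_simps)

lemma dual_quad_add: "dual_quad (z + w) = dual_quad z + dual_polar z w + dual_quad w"
  by (simp add: dual_form_simps)

lemma dual_quad_scale: "dual_quad (c *\<^sub>R z) = c\<^sup>2 * dual_quad z"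
  by (simp add: dual_form_simps power2_eq_square)

lemma dual_quad_minus: "dual_quad (- z) = dual_quad z"
  by (simp add: dual_form_simps)

lemma dual_polar_self: "dual_polar z z = 2 * dual_quad z"
  by (simp add: dual_form_simps)

lemma dual_polar_commute: "dual_polar z w = dual_polar w z"
  by (simp add: dual_polar_def)

lemma dual_polar_scale_right: "dual_polar z (c *\<^sub>R w) = c * dual_polar z w"
  by (simp add: dual_form_simps algebra_simps)

lemma dual_polar_scale_left: "dual_polar (c *\<^sub>R z) w = c * dual_polar z w"
  by (simp add: dual_form_simps algebra_simps)

lemma dual_polar_add_left: "dual_polar (z + z') w = dual_polar z w + dual_polar z' w"
  by (simp add: dual_form_simps)

text \<open>Along the segment from \<open>z\<close> to \<open>w\<close> the form is a quadratic
  polynomial in \<open>t\<close> with leading coefficient \<open>dual_quad (z - w)\<close>; the last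
  term is its deviation from the chord.\<close>

lemma dual_quad_convex_combination:
  "dual_quad (((1 - t) *\<^sub>R z + t *\<^sub>R w) - v)
     = (1 - t) * dual_quad (z - v) + t * dual_quad (w - v) - t * (1 - t) * dual_quad (z - w)"
  by (simp add: dual_form_simps algebra_simps)

lemma continuous_on_dual_quad_diff: "continuous_on U (\<lambda>z. dual_quad (z - w))"
  unfolding dual_quad_def pairing_def by (intro continuous_intros)

section \<open>Orthogonals with respect to the polar form\<close>

lemma mem_perp_op_iff: "z \<in> perp_op B \<longleftrightarrow> (\<forall>w\<in>B. dual_polar z w = 0)"
  by (cases z) (auto simp: perp_op_def dual_polar_def add.commute)

lemma subspace_perp_op: "subspace (perp_op B)"
proof -
  have "z + w \<in> perp_op B" if "z \<in> perp_op B" "w \<in> perp_op B" for z w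
    using that by (simp add: mem_perp_op_iff dual_polar_add_left)
  moreover have "c *\<^sub>R z \<in> perp_op B" if "z \<in> perp_op B" for c z
    using that by (simp add: mem_perp_op_iff dual_polar_scale_left)
  moreover have "0 \<in> perp_op B"
    by (auto simp: mem_perp_op_iff dual_form_simps)
  ultimately show ?thesis unfolding subspace_def by blast
qed

lemma subset_perp_op_perp_op: "B \<subseteq> perp_op (perp_op B)"
  by (auto simp: mem_perp_op_iff dual_polar_commute)

text \<open>Reflexivity represents every continuous functional on the product as
  \<open>dual_polar\<close> against some \<open>w\<close>. A functional separating \<open>z\<close>
  from \<open>S\<close> thus yields \<open>w\<close> in \<open>perp_op S\<close> not orthogonal to
  \<open>z\<close>.\<close>

lemma perp_op_perp_op_closed_subspace:
  fixes S :: "('a::real_normed_vector \<times> ('a \<Rightarrow>\<^sub>L real)) set"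
  assumes refl: "reflexive_space TYPE('a)" and S: "subspace S" "closed S"
  shows "perp_op (perp_op S) = S"
proof
  show "perp_op (perp_op S) \<subseteq> S"
  proof (rule ccontr)
    assume "\<not> perp_op (perp_op S) \<subseteq> S"
    then obtain z where z: "z \<in> perp_op (perp_op S)" "z \<notin> S" by blast
    obtain f :: "('a \<times> ('a \<Rightarrow>\<^sub>L real)) \<Rightarrow>\<^sub>L real"
      where fS: "\<And>s. s \<in> S \<Longrightarrow> f s = 0" and fz: "f z \<noteq> 0"
      using Hahn_Banach_separate_subspace[OF S z(2)] by blast
    have bl1: "bounded_linear (\<lambda>x. f (x, 0))"
      by (intro bounded_linear_compose[OF blinfun.bounded_linear_right] bounded_linear_Pair
          bounded_linear_ident bounded_linear_zero)
    have bl2: "bounded_linear (\<lambda>x'. f (0, x'))"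
      by (intro bounded_linear_compose[OF blinfun.bounded_linear_right] bounded_linear_Pair
          bounded_linear_ident bounded_linear_zero)
    obtain y where y: "\<And>g. f (0, g) = blinfun_apply g y"
      using refl bounded_linear_Blinfun_apply[OF bl2] unfolding reflexive_space_def by metis
    \<comment> \<open>The components cross over: the part of \<open>f\<close> acting on the space
      becomes the dual component of \<open>w\<close>, and the part acting on the dual becomes the
      point \<open>y\<close>.\<close>
    define w where "w = (y, Blinfun (\<lambda>x. f (x, 0)))"
    have f_eq: "f u = dual_polar u w" for u
    proof -
      have "f u = f ((fst u, 0) + (0, snd u))" by simp
      also have "\<dots> = f (fst u, 0) + f (0, snd u)" by (rule blinfun.add_right)
      finally show ?thesis
        using bounded_linear_Blinfun_apply[OF bl1] y
        by (simp add: w_def dual_polar_def pairing_def)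
    qed
    have "w \<in> perp_op S"
      using fS f_eq by (auto simp: mem_perp_op_iff dual_polar_commute[of w])
    then show False using z(1) fz f_eq by (auto simp: mem_perp_op_iff)
  qed
qed (rule subset_perp_op_perp_op)

section \<open>Monotone operators and their enlargements\<close>

lemma monotone_op_iff: "monotone_op T \<longleftrightarrow> (\<forall>z\<in>T. \<forall>w\<in>T. 0 \<le> dual_quad (z - w))"
  by (force simp: monotone_op_def dual_quad_def)

text \<open>Maximality can be tested by inserting one point at a time: a point monotonically related
  to all of \<open>T\<close> extends \<open>T\<close> to a monotone set.\<close>

lemma maximal_monotone_iff:
  "maximal_monotone T \<longleftrightarrow> (\<forall>z. z \<in> T \<longleftrightarrow> (\<forall>w\<in>T. 0 \<le> dual_quad (z - w)))"
proof
  assume T: "maximal_monotone T"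
  then have mono: "\<forall>z\<in>T. \<forall>w\<in>T. 0 \<le> dual_quad (z - w)"
    by (simp add: maximal_monotone_def monotone_op_iff)
  have "z \<in> T" if z: "\<forall>w\<in>T. 0 \<le> dual_quad (z - w)" for z
  proof -
    have "\<forall>w\<in>T. 0 \<le> dual_quad (w - z)"
      using z by (metis dual_quad_minus minus_diff_eq)
    then have "monotone_op (insert z T)"
      using mono z by (auto simp: monotone_op_iff dual_form_simps)
    then have "insert z T = T" using T by (auto simp: maximal_monotone_def)
    then show ?thesis by blast
  qed
  with mono show "\<forall>z. z \<in> T \<longleftrightarrow> (\<forall>w\<in>T. 0 \<le> dual_quad (z - w))" by blast
next
  assume T: "\<forall>z. z \<in> T \<longleftrightarrow> (\<forall>w\<in>T. 0 \<le> dual_quad (z - w))"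
  have "S = T" if "monotone_op S" "T \<subseteq> S" for S
    using T that unfolding monotone_op_iff by blast
  then show "maximal_monotone T"
    using T by (auto simp: maximal_monotone_def monotone_op_iff)
qed

lemma maximal_monotone_memI:
  "maximal_monotone T \<Longrightarrow> (\<And>w. w \<in> T \<Longrightarrow> 0 \<le> dual_quad (z - w)) \<Longrightarrow> z \<in> T"
  unfolding maximal_monotone_iff by blast

lemma maximal_monotoneD:
  "maximal_monotone T \<Longrightarrow> z \<in> T \<Longrightarrow> w \<in> T \<Longrightarrow> 0 \<le> dual_quad (z - w)"
  unfolding maximal_monotone_iff by blast

lemma maximal_monotone_nonempty: "maximal_monotone T \<Longrightarrow> T \<noteq> {}"
  by (auto simp: maximal_monotone_iff)

lemma maximal_monotone_translate:
  "maximal_monotone T \<Longrightarrow> maximal_monotone ((\<lambda>z. z - a) ` T)"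
proof -
  assume T: "maximal_monotone T"
  have mem: "z \<in> (\<lambda>z. z - a) ` T \<longleftrightarrow> z + a \<in> T" for z
    by (force simp: image_iff)
  have "(\<forall>w\<in>(\<lambda>z. z - a) ` T. 0 \<le> dual_quad (z - w)) \<longleftrightarrow> (\<forall>w\<in>T. 0 \<le> dual_quad (z + a - w))" for z
    by (simp add: algebra_simps)
  then show ?thesis
    using T by (simp only: maximal_monotone_iff mem) blast
qed

lemma closed_maximal_monotone:
  assumes "maximal_monotone T" shows "closed T"
proof -
  have "T = (\<Inter>w\<in>T. {z. 0 \<le> dual_quad (z - w)})"
    using assms by (auto simp: maximal_monotone_iff)
  moreover have "closed {z. 0 \<le> dual_quad (z - w)}" for w :: "'a \<times> ('a \<Rightarrow>\<^sub>L real)"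
    by (intro closed_Collect_le continuous_on_const continuous_on_dual_quad_diff)
  ultimately show ?thesis by (metis (no_types, lifting) closed_INT)
qed

section \<open>Enlargements and the structure of non-enlargeable operators\<close>

lemma mem_enlargement_iff: "z \<in> enlargement T \<epsilon> \<longleftrightarrow> (\<forall>w\<in>T. - \<epsilon> \<le> dual_quad (z - w))"
  by (cases z) (auto simp: enlargement_def dual_quad_def)

text \<open>A uniform lower bound of either sign suffices; \<open>max 0 (- c)\<close> turns it into
  an admissible enlargement parameter.\<close>

lemma non_enlargeable_memI:
  assumes "non_enlargeable T" and "\<And>w. w \<in> T \<Longrightarrow> c \<le> dual_quad (z - w)"
  shows "z \<in> T"
proof -
  have "z \<in> enlargement T (max 0 (- c))"
    using assms(2) by (force simp: mem_enlargement_iff)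
  then show ?thesis
    using assms(1) by (simp add: non_enlargeable_def)
qed

lemma non_enlargeableI:
  assumes "monotone_op T" and "\<And>z c. (\<And>w. w \<in> T \<Longrightarrow> c \<le> dual_quad (z - w)) \<Longrightarrow> z \<in> T"
  shows "non_enlargeable T"
  unfolding non_enlargeable_def
proof (intro allI impI set_eqI iffI)
  fix \<epsilon> :: real and z assume "0 \<le> \<epsilon>" "z \<in> T"
  then show "z \<in> enlargement T \<epsilon>"
    using assms(1) by (force simp: mem_enlargement_iff monotone_op_iff)
next
  fix \<epsilon> :: real and z assume "z \<in> enlargement T \<epsilon>"
  then show "z \<in> T" using assms(2)[of "- \<epsilon>" z] by (simp add: mem_enlargement_iff)
qed

text \<open>The deviation from the chord does not depend on the test point \<open>v\<close>, so it
  serves as a uniform lower bound.\<close>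

lemma convex_non_enlargeable:
  assumes mono: "maximal_monotone T" and ne: "non_enlargeable T"
  shows "convex T"
proof (unfold convex_alt, intro ballI allI impI)
  fix z w and t :: real assume zw: "z \<in> T" "w \<in> T" and t: "0 \<le> t \<and> t \<le> 1"
  show "(1 - t) *\<^sub>R z + t *\<^sub>R w \<in> T"
  proof (rule non_enlargeable_memI[OF ne])
    fix v assume v: "v \<in> T"
    have "0 \<le> (1 - t) * dual_quad (z - v)" "0 \<le> t * dual_quad (w - v)"
      using t maximal_monotoneD[OF mono zw(1) v] maximal_monotoneD[OF mono zw(2) v] by simp_all
    then show "- (t * (1 - t) * dual_quad (z - w)) \<le> dual_quad ((1 - t) *\<^sub>R z + t *\<^sub>R w - v)"
      unfolding dual_quad_convex_combination by simp
  qed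
qed

lemma subspace_convex_maximal_monotone:
  assumes mono: "maximal_monotone S" and conv: "convex S" and zero: "0 \<in> S"
  shows "subspace S"
proof -
  have shrink: "c *\<^sub>R z \<in> S" if "z \<in> S" "0 \<le> c" "c \<le> 1" for c z
    using convexD_alt[OF conv zero that(1), of c] that by simp
  have cone: "c *\<^sub>R z \<in> S" if z: "z \<in> S" and "0 \<le> c" for c z
  proof (cases "c \<le> 1")
    \<comment> \<open>For \<open>c > 1\<close> the factor is moved onto the test point:
      \<open>inverse c *\<^sub>R w\<close> stays in \<open>S\<close> by convexity.\<close>
    case False
    show ?thesis
    proof (rule maximal_monotone_memI[OF mono])
      fix w assume "w \<in> S"
      then have "inverse c *\<^sub>R w \<in> S" using False by (intro shrink) (auto simp: field_simps)
      from maximal_monotoneD[OF mono z this]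
      have "0 \<le> c\<^sup>2 * dual_quad (z - inverse c *\<^sub>R w)" by simp
      also have "\<dots> = dual_quad (c *\<^sub>R (z - inverse c *\<^sub>R w))" by (simp only: dual_quad_scale)
      also have "c *\<^sub>R (z - inverse c *\<^sub>R w) = c *\<^sub>R z - w" using False by (simp add: algebra_simps)
      finally show "0 \<le> dual_quad (c *\<^sub>R z - w)" .
    qed
  qed (use shrink that in blast)
  have add: "z + w \<in> S" if "z \<in> S" "w \<in> S" for z w
  proof -
    have "2 *\<^sub>R ((1 - 1/2) *\<^sub>R z + (1/2) *\<^sub>R w) \<in> S"
      using convexD_alt[OF conv that, of "1/2"] by (intro cone) auto
    then show ?thesis by (simp add: algebra_simps)
  qed
  \<comment> \<open>The form is even, so comparing \<open>- z\<close> with \<open>w\<close> amounts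
    to comparing \<open>z + w\<close> with \<open>0\<close>, and both of these lie in
    \<open>S\<close>.\<close>
  have neg: "- z \<in> S" if "z \<in> S" for z
  proof (rule maximal_monotone_memI[OF mono])
    fix w assume "w \<in> S"
    then have "0 \<le> dual_quad (z + w - 0)"
      by (intro maximal_monotoneD[OF mono add zero] that)
    then show "0 \<le> dual_quad (- z - w)"
      using dual_quad_minus[of "z + w"] by simp
  qed
  have "c *\<^sub>R z \<in> S" if "z \<in> S" for c z
    using cone[OF that, of c] cone[OF neg[OF that], of "- c"] by (cases "0 \<le> c") auto
  with zero add show ?thesis unfolding subspace_def by blast
qed

lemma non_enlargeable_translate:
  assumes "monotone_op T" "non_enlargeable T"
  shows "non_enlargeable ((\<lambda>z. z - a) ` T)"
proof (rule non_enlargeableI)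
  show "monotone_op ((\<lambda>z. z - a) ` T)"
    using assms(1) by (simp add: monotone_op_iff)
  fix z c assume z: "\<And>w. w \<in> (\<lambda>z. z - a) ` T \<Longrightarrow> c \<le> dual_quad (z - w)"
  have "z + a \<in> T"
  proof (rule non_enlargeable_memI[OF assms(2)])
    fix w assume "w \<in> T"
    then show "c \<le> dual_quad (z + a - w)"
      using z[of "w - a"] by (simp add: algebra_simps)
  qed
  then show "z \<in> (\<lambda>z. z - a) ` T" by (force simp: image_iff)
qed

lemma non_enlargeable_perp_op_self_cancelling:
  assumes A: "self_cancelling A" and mono: "monotone_op (perp_op A)"
  shows "non_enlargeable (perp_op A)"
proof (rule non_enlargeableI[OF mono])
  have sub: "subspace A" and quad0: "dual_quad a = 0" if "a \<in> A" for a
    using A that by (cases a; simp add: self_cancelling_def dual_quad_def)+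
  \<comment> \<open>Polarization makes \<open>dual_polar\<close> vanish on \<open>A\<close>, so
    \<open>A\<close> lies in \<open>perp_op A\<close> and all multiples of its elements are
    available as test points.\<close>
  have A_sub: "c *\<^sub>R a \<in> perp_op A" if "a \<in> A" for a and c :: real
  proof -
    have "dual_polar a b = 0" if "b \<in> A" for b
      using dual_quad_add[of a b] quad0[of "a + b"] quad0[of a] quad0[of b] \<open>a \<in> A\<close> that
        subspace_add[OF sub] by auto
    then have "a \<in> perp_op A" by (simp add: mem_perp_op_iff)
    then show ?thesis by (rule subspace_scale[OF subspace_perp_op])
  qed
  fix z c assume bound: "\<And>w. w \<in> perp_op A \<Longrightarrow> c \<le> dual_quad (z - w)"
  have "dual_polar z a = 0" if a: "a \<in> A" for a
  proof (rule ccontr)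
    assume nz: "dual_polar z a \<noteq> 0"
    \<comment> \<open>Chosen so that the affine function
      \<open>dual_quad z - t * dual_polar z a\<close> takes the value \<open>c - 1\<close>, below
      the assumed bound.\<close>
    define t where "t = (dual_quad z - c + 1) / dual_polar z a"
    have "c \<le> dual_quad (z - t *\<^sub>R a)" by (rule bound[OF A_sub[OF a]])
    also have "\<dots> = dual_quad z - t * dual_polar z a"
      by (simp add: dual_quad_diff dual_quad_scale dual_polar_scale_right quad0[OF a])
    also have "\<dots> = c - 1" using nz by (simp add: t_def)
    finally show False by simp
  qed
  then show "z \<in> perp_op A" by (simp add: mem_perp_op_iff)
qed

text \<open>Each \<open>y\<close> in \<open>perp_op S\<close> turns out to lie in \<open>S\<close>,
  hence is orthogonal to itself, and \<open>dual_polar y y\<close> is twice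
  \<open>dual_quad y\<close>.\<close>

lemma self_cancelling_perp_op:
  assumes mono: "maximal_monotone S" and ne: "non_enlargeable S" and zero: "0 \<in> S"
  shows "self_cancelling (perp_op S)"
proof -
  have "dual_quad y = 0" if y: "y \<in> perp_op S" for y
  proof -
    have "y \<in> S"
    proof (rule non_enlargeable_memI[OF ne])
      fix s assume s: "s \<in> S"
      then show "dual_quad y \<le> dual_quad (y - s)"
        using y maximal_monotoneD[OF mono s zero] by (simp add: dual_quad_diff[of y s] mem_perp_op_iff)
    qed
    then show ?thesis using y dual_polar_self[of y] by (auto simp: mem_perp_op_iff)
  qed
  then show ?thesis
    using subspace_perp_op by (force simp: self_cancelling_def dual_quad_def)
qed

theorem theorem1:
  fixes T :: "('a::banach \<times> ('a \<Rightarrow>\<^sub>L real)) set"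
  assumes "reflexive_space TYPE('a)"
    and "maximal_monotone T"
  shows "(non_enlargeable T \<longleftrightarrow>
            (\<exists>A x x'. self_cancelling A \<and> maximal_monotone (perp_op A) \<and>
               T = (\<lambda>(y, y'). (y + x, y' + x')) ` perp_op A))
       \<and> (\<forall>x x'. non_enlargeable T \<and> (x, x') \<in> T \<longrightarrow>
            (let S = (\<lambda>(y, y'). (y - x, y' - x')) ` T in
               S = perp_op (perp_op S) \<and> (\<forall>A. S = perp_op A \<longrightarrow> A \<subseteq> perp_op S)))"
proof -
  have shift_minus: "(\<lambda>(y, y'). (y - x, y' - x')) = (\<lambda>z. z - (x, x'))" for x :: 'a and x' :: "'a \<Rightarrow>\<^sub>L real"
    by auto
  have shift_plus: "(\<lambda>(y, y'). (y + x, y' + x')) = (\<lambda>z. z - (- (x, x')))" for x :: 'a and x' :: "'a \<Rightarrow>\<^sub>L real"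
    by auto
  \<comment> \<open>Stated for an arbitrary base point \<open>a\<close> of \<open>T\<close>, so that
    it serves both the existence of \<open>A\<close> and the claim about every
    \<open>(x, x')\<close> in \<open>T\<close>.\<close>
  have bipolar: "maximal_monotone ((\<lambda>z. z - a) ` T)" "self_cancelling (perp_op ((\<lambda>z. z - a) ` T))"
    "perp_op (perp_op ((\<lambda>z. z - a) ` T)) = (\<lambda>z. z - a) ` T"
    if ne: "non_enlargeable T" and a: "a \<in> T" for a
  proof -
    let ?S = "(\<lambda>z. z - a) ` T"
    show mm: "maximal_monotone ?S" by (rule maximal_monotone_translate[OF assms(2)])
    have neS: "non_enlargeable ?S"
      using assms(2) ne by (intro non_enlargeable_translate) (auto simp: maximal_monotone_def)
    have zero: "0 \<in> ?S" using a by (force simp: image_iff)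
    show "self_cancelling (perp_op ?S)" by (rule self_cancelling_perp_op[OF mm neS zero])
    have "subspace ?S"
      by (rule subspace_convex_maximal_monotone[OF mm convex_non_enlargeable[OF mm neS] zero])
    then show "perp_op (perp_op ?S) = ?S"
      by (rule perp_op_perp_op_closed_subspace[OF assms(1) _ closed_maximal_monotone[OF mm]])
  qed
  have "\<exists>A x x'. self_cancelling A \<and> maximal_monotone (perp_op A) \<and>
          T = (\<lambda>(y, y'). (y + x, y' + x')) ` perp_op A" if ne: "non_enlargeable T"
  proof -
    obtain x x' where a: "(x, x') \<in> T" using maximal_monotone_nonempty[OF assms(2)] by auto
    let ?S = "(\<lambda>z. z - (x, x')) ` T"
    have "T = (\<lambda>(y, y'). (y + x, y' + x')) ` ?S"
      unfolding shift_plus image_image diff_minus_eq_add diff_add_cancel by simp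
    with bipolar[OF ne a] show ?thesis
      by (intro exI[of _ "perp_op ?S"] exI[of _ x] exI[of _ x']) simp
  qed
  moreover have "non_enlargeable T"
    if "self_cancelling A" "maximal_monotone (perp_op A)"
      and T: "T = (\<lambda>(y, y'). (y + x, y' + x')) ` perp_op A" for A x x'
    unfolding T shift_plus using that(1,2)
    by (intro non_enlargeable_translate non_enlargeable_perp_op_self_cancelling)
      (auto simp: maximal_monotone_def)
  \<comment> \<open>For the largest choice: if \<open>S = perp_op A\<close>, then \<open>A\<close>
    lies in \<open>perp_op (perp_op A)\<close>, which is \<open>perp_op S\<close>.\<close>
  ultimately show ?thesis
    unfolding shift_minus Let_def using bipolar(3) subset_perp_op_perp_op by metis
qed

end
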